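(* For every integer $d\ge 1$, $\hat{\delta}_{B_d}\ge\lfloor d/3\rfloor-1$.
   Context: $B_d$ is the complete binary tree of depth $d$, where depth is the number of vertices on a root-to-leaf path; thus $B_d$ has $2^d-1$ vertices and all its leaves are at the same level. For a finite graph $G$ and $1\le i\le|V(G)|$, $\delta(i,G)$ is the least number of edges in a cut $(X,\overline X)$ (the set of edges between $X$ and $V(G)\setminus X$) over all $X\subseteq V(G)$ with $|X|=i$. The edge isoperimetric peak of $G$ is $\hat\delta_G=\max_{1\le i\le|V(G)|}\delta(i,G)$. *)

theory Defs
  imports Complex_Main
begin

text \<open>An undirected simple graph is a pair of a vertex set and a set of edges,
  each edge being a two-element set of vertices.\<close>

type_synonym 'a ugraph = "'a set \<times> 'a set set"

abbreviation verts :: "'a ugraph \<Rightarrow> 'a set" where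
  "verts G \<equiv> fst G"

abbreviation edges :: "'a ugraph \<Rightarrow> 'a set set" where
  "edges G \<equiv> snd G"

definition finite_simple_graph :: "'a ugraph \<Rightarrow> bool" where
  "finite_simple_graph G \<longleftrightarrow>
     finite (verts G) \<and> (\<forall>e\<in>edges G. e \<subseteq> verts G \<and> card e = 2)"

definition cut :: "'a ugraph \<Rightarrow> 'a set \<Rightarrow> 'a set set" where
  "cut G X = {e \<in> edges G. \<exists>x\<in>X. \<exists>y\<in>verts G - X. e = {x, y}}"

text \<open>For a finite graph with at least \<open>i\<close> vertices, the minimum is over a
  nonempty finite set.\<close>

definition edge_iso :: "nat \<Rightarrow> 'a ugraph \<Rightarrow> nat" where
  "edge_iso i G = Min {card (cut G X) | X. X \<subseteq> verts G \<and> card X = i}"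

text \<open>Meaningful for finite graphs with at least one vertex.\<close>

definition iso_peak :: "'a ugraph \<Rightarrow> nat" where
  "iso_peak G = Max ((\<lambda>i. edge_iso i G) ` {1..card (verts G)})"

text \<open>Vertices of the complete binary tree are addressed by the sequence of left/right
  choices on the path from the root \<open>[]\<close>. The address of a vertex is one shorter than the
  number of vertices on that path, so depth \<open>d\<close> means addresses of length less than \<open>d\<close>.\<close>

definition binary_tree :: "nat \<Rightarrow> bool list ugraph" where
  "binary_tree d =
     ({xs. length xs < d}, {{xs, xs @ [b]} | xs b. length (xs @ [b]) < d})"

lemma bool_lists_Suc:
  "{xs :: bool list. length xs < Suc d} = {xs. length xs < d} \<union> {xs. length xs = d}"
  by auto

lemma bool_lists_length:
  "finite {xs :: bool list. length xs = d}" "card {xs :: bool list. length xs = d} = 2 ^ d"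
  using finite_lists_length_eq[of "UNIV :: bool set" d]
    card_lists_length_eq[of "UNIV :: bool set" d] by simp_all

lemma finite_verts_binary_tree: "finite (verts (binary_tree d))"
  unfolding binary_tree_def fst_conv
  by (induction d) (simp_all add: bool_lists_Suc bool_lists_length)

lemma card_verts_binary_tree: "card (verts (binary_tree d)) = 2 ^ d - 1"
proof (induction d)
  case 0
  then show ?case by (simp add: binary_tree_def)
next
  case (Suc d)
  have "card {xs :: bool list. length xs < Suc d}
      = card {xs :: bool list. length xs < d} + card {xs :: bool list. length xs = d}"
    unfolding bool_lists_Suc using finite_verts_binary_tree[of d]
    by (intro card_Un_disjoint) (auto simp: binary_tree_def bool_lists_length)
  then show ?case
    using Suc by (simp add: binary_tree_def bool_lists_length)
qed

lemma finite_simple_graph_binary_tree: "finite_simple_graph (binary_tree d)"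
  using finite_verts_binary_tree[of d]
  by (auto simp: finite_simple_graph_def binary_tree_def card_insert_if)

end

theory Submission
  imports Defs
begin

text \<open>
  Let \<open>a \<in> {0, 1}\<close> indicate whether the root lies in \<open>X\<close>. Each cut edge, with lower endpoint \<open>v\<close>,
  corrects the count of \<open>X\<close> by \<open>\<plusminus>(2 ^ h(v) - 1)\<close>, the size of the subtree below \<open>v\<close>. Hence,
  for a cut with \<open>c\<close> edges, \<open>card X + s\<close> is a sum of \<open>a + c\<close> signed powers of two for some
  \<open>\<bar>s\<bar> \<le> a + c\<close>. Since \<open>s\<close> itself is a sum of about \<open>\<bar>s\<bar> / 2\<close> terms \<open>\<plusminus>2\<close>, the number \<open>card X\<close>
  is a sum of about \<open>3c / 2\<close> signed powers of two. For \<open>card X = 1 + 4 + \<dots> + 4 ^ (m - 1)\<close> with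
  \<open>m \<approx> d / 2\<close>, at least \<open>m\<close> such terms are needed, so \<open>c\<close> is about \<open>d / 3\<close> or larger.
\<close>

section \<open>Sums of signed powers of two\<close>

text \<open>The least number of signed powers of two with sum \<open>n\<close>.\<close>

function signed_weight :: "int \<Rightarrow> nat" where
  "signed_weight n =
     (if \<bar>n\<bar> \<le> 1 then nat \<bar>n\<bar>
      else if even n then signed_weight (n div 2)
      else 1 + min (signed_weight (n div 2)) (signed_weight (n div 2 + 1)))"
  by auto
termination
  by (relation "measure (\<lambda>n. nat \<bar>n\<bar>)") (auto, presburger+)

declare signed_weight.simps [simp del]

lemma signed_weight_0 [simp]: "signed_weight 0 = 0"
  by (simp add: signed_weight.simps)

lemma signed_weight_double [simp]: "signed_weight (2 * n) = signed_weight n"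
proof (cases "n = 0")
  case False
  then show ?thesis by (subst signed_weight.simps) auto
qed simp

lemma signed_weight_double_plus_1:
  "signed_weight (2 * n + 1) = 1 + min (signed_weight n) (signed_weight (n + 1))"
proof -
  consider "n = 0" | "n = - 1" | "\<bar>2 * n + 1\<bar> > 1" by linarith
  then show ?thesis
  proof cases
    case 3
    then show ?thesis by (subst signed_weight.simps) auto
  qed (simp_all add: signed_weight.simps)
qed

text \<open>One of \<open>n\<close> and \<open>n + 1\<close> is \<open>2 * k\<close>, and the weight
  of the other is one more than the smaller of the weights of \<open>k\<close> and a neighbour of
  \<open>k\<close>. By induction on the absolute value these two differ by at most 1.\<close>

lemma signed_weight_plus_1:
  "signed_weight (n + 1) \<le> signed_weight n + 1 \<and> signed_weight n \<le> signed_weight (n + 1) + 1"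
proof (induction "nat \<bar>n\<bar>" arbitrary: n rule: less_induct)
  case less
  show ?case
  proof (cases "even n")
    case True
    then obtain k where n: "n = 2 * k" by blast
    show ?thesis
    proof (cases "k = 0")
      case False
      then have "nat \<bar>k\<bar> < nat \<bar>n\<bar>" using n by auto
      from less[OF this] show ?thesis
        unfolding n signed_weight_double_plus_1 by auto
    qed (simp add: n signed_weight.simps)
  next
    case False
    then obtain k where n: "n = 2 * k + 1" by (blast elim: oddE)
    have n1: "n + 1 = 2 * (k + 1)" using n by simp
    show ?thesis
    proof (cases "k = -1")
      case False
      then have "nat \<bar>k\<bar> < nat \<bar>n\<bar>" using n by auto
      from less[OF this] show ?thesis
        unfolding n1 signed_weight_double unfolding n signed_weight_double_plus_1 by auto
    qed (simp add: n signed_weight.simps)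
  qed
qed

text \<open>Adding \<open>2 ^ Suc k\<close> preserves parity and adds \<open>2 ^ k\<close> to the
  half of an even \<open>n\<close>, or to both candidate halves \<open>l\<close> and
  \<open>l + 1\<close> of an odd one.\<close>

lemma signed_weight_plus_power:
  "signed_weight (n + 2 ^ k) \<le> signed_weight n + 1 \<and>
   signed_weight n \<le> signed_weight (n + 2 ^ k) + 1"
proof (induction k arbitrary: n)
  case 0
  then show ?case using signed_weight_plus_1[of n] by simp
next
  case (Suc k)
  show ?case
  proof (cases "even n")
    case True
    then obtain l where n: "n = 2 * l" by blast
    have "n + 2 ^ Suc k = 2 * (l + 2 ^ k)" using n by simp
    then show ?thesis using Suc[of l] by (simp only: n signed_weight_double)
  next
    case False
    then obtain l where n: "n = 2 * l + 1" by (blast elim: oddE)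
    have "n + 2 ^ Suc k = 2 * (l + 2 ^ k) + 1" using n by simp
    moreover have "l + 2 ^ k + 1 = (l + 1) + 2 ^ k" by simp
    ultimately show ?thesis using Suc[of l] Suc[of "l + 1"]
      unfolding n by (simp only: signed_weight_double_plus_1) linarith
  qed
qed

lemma signed_weight_plus_sum:
  fixes s :: "'a \<Rightarrow> int"
  assumes "finite C" and "\<And>v. v \<in> C \<Longrightarrow> s v = 1 \<or> s v = - 1"
  shows "signed_weight (n + (\<Sum>v\<in>C. s v * 2 ^ h v)) \<le> signed_weight n + card C"
  using assms
proof (induction C)
  case (insert v C)
  let ?t = "n + (\<Sum>v\<in>C. s v * 2 ^ h v)"
  have "signed_weight (?t + s v * 2 ^ h v) \<le> signed_weight ?t + 1"
    using insert.prems[of v] signed_weight_plus_power[of ?t "h v"]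
      signed_weight_plus_power[of "?t - 2 ^ h v" "h v"] by auto
  moreover have "signed_weight ?t \<le> signed_weight n + card C"
    using insert by blast
  moreover have "n + (\<Sum>v\<in>insert v C. s v * 2 ^ h v) = ?t + s v * 2 ^ h v"
    using insert by simp
  moreover have "card (insert v C) = card C + 1" using insert by simp
  ultimately show ?case by (simp add: add.assoc)
qed simp

text \<open>Two units merge into the single power 2, so a shift by \<open>k\<close> costs at most
  \<open>k / 2\<close> rounded up. This saving gives the factor 3/2 instead of 2 in the final
  bound.\<close>

lemma signed_weight_plus_nat:
  "2 * signed_weight n \<le> 2 * signed_weight (n + int k) + k + 1 \<and>
   2 * signed_weight (n + int k) \<le> 2 * signed_weight n + k + 1"
proof (induction k arbitrary: n rule: less_induct)
  case (less k)
  show ?case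
  proof (cases "k < 2")
    case True
    then have "k = 0 \<or> k = 1" by auto
    then show ?thesis using signed_weight_plus_1[of n] by auto
  next
    case False
    then obtain j where k: "k = j + 2"
      by (metis add.commute le_Suc_ex not_less)
    show ?thesis
      using less[of j n] signed_weight_plus_power[of "n + int j" 1] k by (auto simp: ac_simps)
  qed
qed

lemma signed_weight_diff_le:
  "2 * int (signed_weight n) \<le> 2 * int (signed_weight (n + s)) + \<bar>s\<bar> + 1"
proof (cases "s \<ge> 0")
  case True
  then show ?thesis using signed_weight_plus_nat[of n "nat s"] by simp linarith
next
  case False
  then show ?thesis using signed_weight_plus_nat[of "n + s" "nat (- s)"] by simp linarith
qed

text \<open>Passing from \<open>x\<close> to \<open>4 * x + 1\<close> gives weight 1 plus the
  minimum over \<open>2 * x\<close> and \<open>2 * x + 1\<close>. The latter weighs at least as much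
  as \<open>x\<close>, since \<open>x + 1\<close> is at most one lighter than
  \<open>x\<close>.\<close>

lemma signed_weight_sum_powers_4: "m \<le> signed_weight (\<Sum>j<m. 4 ^ j)"
proof (induction m)
  case (Suc m)
  let ?x = "\<Sum>j<m. 4 ^ j :: int"
  have "(\<Sum>j<Suc m. 4 ^ j :: int) = 2 * (2 * ?x) + 1"
    by (subst sum.lessThan_Suc_shift) (simp add: sum_distrib_left mult.assoc[symmetric])
  then show ?case
    using Suc signed_weight_plus_1[of ?x] by (simp only: signed_weight_double_plus_1 signed_weight_double) linarith
qed simp

section \<open>Counting a vertex set through its cut edges\<close>

lemma sum_bool_lists_shorter_Suc:
  fixes g :: "bool list \<Rightarrow> int"
  shows "(\<Sum>v | length v < Suc d. g v)
    = g [] + (\<Sum>v | length v < d. g (True # v)) + (\<Sum>v | length v < d. g (False # v))"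
proof -
  have fin: "finite {v :: bool list. length v < d}" for d
    using finite_verts_binary_tree[of d] by (simp add: binary_tree_def)
  let ?V = "{v :: bool list. length v < d}"
  have "{v :: bool list. length v < Suc d} = insert [] ((#) True ` ?V \<union> (#) False ` ?V)"
  proof (intro equalityI subsetI)
    fix v :: "bool list" assume "v \<in> {v. length v < Suc d}"
    then show "v \<in> insert [] ((#) True ` ?V \<union> (#) False ` ?V)"
      by (cases v; cases "hd v") auto
  qed auto
  moreover have "(\<Sum>v\<in>(#) True ` ?V \<union> (#) False ` ?V. g v)
      = (\<Sum>v\<in>?V. g (True # v)) + (\<Sum>v\<in>?V. g (False # v))"
    using fin by (subst sum.union_disjoint) (auto simp: sum.reindex)
  moreover have "[] \<notin> (#) True ` ?V \<union> (#) False ` ?V" by auto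
  ultimately show ?thesis using fin[of d] by simp
qed

text \<open>Each \<open>g v\<close> is \<open>g []\<close> plus the increments along the path from
  the root to \<open>v\<close>. The increment at \<open>u\<close> is thus counted once for each of
  the \<open>2 ^ (d - length u) - 1\<close> vertices of the subtree at \<open>u\<close>. The root
  contributes 0 to the second sum because \<open>butlast [] = []\<close>.\<close>

lemma sum_binary_tree_telescope:
  fixes g :: "bool list \<Rightarrow> int"
  shows "(\<Sum>v | length v < d. g v) = g [] * (2 ^ d - 1)
    + (\<Sum>v | length v < d. (g v - g (butlast v)) * (2 ^ (d - length v) - 1))"
proof (induction d arbitrary: g)
  case (Suc d)
  let ?D = "\<lambda>g d v. (g v - g (butlast v)) * (2 ^ (d - length v) - 1) :: int"
  \<comment> \<open>The induction hypothesis for a child subtree has increment 0 at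
    \<open>v = []\<close>, where the whole tree has \<open>g [b] - g []\<close>; all other summands
    agree.\<close>
  have step: "(\<Sum>v | length v < d. g (b # v)) = g [] * (2 ^ d - 1)
      + (\<Sum>v | length v < d. ?D g (Suc d) (b # v))" for b
  proof (cases d)
    case (Suc e)
    have root: "[] \<in> {v :: bool list. length v < d}" using Suc by simp
    have fin: "finite {v :: bool list. length v < d}"
      using finite_verts_binary_tree[of d] by (simp add: binary_tree_def)
    have "(\<Sum>v \<in> {v. length v < d} - {[]}. ?D g (Suc d) (b # v))
        = (\<Sum>v \<in> {v. length v < d} - {[]}. ?D (\<lambda>v. g (b # v)) d v)"
      by (rule sum.cong) auto
    then show ?thesis
      using Suc.IH[of "\<lambda>v. g (b # v)"]
      by (simp add: sum.remove[OF fin root] algebra_simps)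
  qed simp
  show ?case
    unfolding sum_bool_lists_shorter_Suc step by (simp add: algebra_simps)
qed simp

text \<open>A vertex other than the root determines the edge to its parent; the root is excluded
  automatically, as \<open>butlast [] = []\<close>.\<close>

lemma card_boundary_vertices_le_cut:
  "card {v. length v < d \<and> (v \<in> X) \<noteq> (butlast v \<in> X)} \<le> card (cut (binary_tree d) X)"
proof -
  let ?C = "{v. length v < d \<and> (v \<in> X) \<noteq> (butlast v \<in> X)}"
  let ?e = "\<lambda>v :: bool list. {butlast v, v}"
  have "inj_on ?e ?C"
  proof (rule inj_onI)
    fix v w assume "?e v = ?e w"
    then consider "v = w" | "v = butlast w" "w = butlast v" by (auto simp: doubleton_eq_iff)
    then show "v = w"
    proof cases
      case 2
      \<comment> \<open>With truncated subtraction, these equations force both lists to be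
        empty.\<close>
      then have "length v = length w - 1" "length w = length v - 1"
        by (metis length_butlast)+
      then show ?thesis by (cases v; cases w) auto
    qed
  qed
  moreover have "?e ` ?C \<subseteq> cut (binary_tree d) X"
  proof
    fix e assume "e \<in> ?e ` ?C"
    then obtain v where v: "e = {butlast v, v}" "length v < d" "(v \<in> X) \<noteq> (butlast v \<in> X)"
      by auto
    then have "v \<noteq> []" by auto
    then obtain xs b where "v = xs @ [b]" by (metis rev_exhaust)
    with v have e: "e = {xs, xs @ [b]}" "length (xs @ [b]) < d" "(xs @ [b] \<in> X) \<noteq> (xs \<in> X)"
      by auto
    then have "e \<in> edges (binary_tree d)" "xs \<in> verts (binary_tree d)"
      "xs @ [b] \<in> verts (binary_tree d)"
      unfolding binary_tree_def by auto
    with e show "e \<in> cut (binary_tree d) X"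
      unfolding cut_def by (cases "xs \<in> X") blast+
  qed
  moreover have "finite (cut (binary_tree d) X)"
  proof (rule finite_subset)
    show "cut (binary_tree d) X \<subseteq> Pow (verts (binary_tree d))"
      using finite_simple_graph_binary_tree[of d]
      by (auto simp: cut_def finite_simple_graph_def)
  qed (simp add: finite_verts_binary_tree)
  ultimately show ?thesis by (rule card_inj_on_le)
qed

text \<open>For \<open>c\<close> boundary vertices, the sum of powers has weight at most
  \<open>1 + c\<close>, and removing the correction \<open>?S\<close> adds at most
  \<open>(2 + c) / 2\<close>. Doubling gives \<open>3 * c + 4\<close>.\<close>

lemma signed_weight_card_le_cut:
  assumes X: "X \<subseteq> verts (binary_tree d)"
  shows "2 * signed_weight (int (card X)) \<le> 3 * card (cut (binary_tree d) X) + 4"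
proof -
  let ?V = "{v :: bool list. length v < d}"
  let ?C = "{v. length v < d \<and> (v \<in> X) \<noteq> (butlast v \<in> X)}"
  define g where "g = (\<lambda>v. if v \<in> X then 1 else 0 :: int)"
  define s where "s = (\<lambda>v. g v - g (butlast v))"
  let ?S = "g [] + (\<Sum>v\<in>?C. s v)"
  let ?P = "\<Sum>v\<in>?C. s v * 2 ^ (d - length v)"
  have s: "s v = 1 \<or> s v = - 1" if "v \<in> ?C" for v
    using that by (auto simp: s_def g_def)
  have fin: "finite ?V"
    using finite_verts_binary_tree[of d] by (simp add: binary_tree_def)
  then have finC: "finite ?C" by (rule rev_finite_subset) auto
  have XV: "X \<subseteq> ?V" using X by (simp add: binary_tree_def)
  have "int (card X) = (\<Sum>v\<in>?V. g v)"
    using fin XV by (simp add: g_def sum.If_cases Int_absorb1)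
  also have "\<dots> = g [] * (2 ^ d - 1) + (\<Sum>v\<in>?V. s v * (2 ^ (d - length v) - 1))"
    unfolding s_def by (rule sum_binary_tree_telescope)
  also have "(\<Sum>v\<in>?V. s v * (2 ^ (d - length v) - 1))
      = (\<Sum>v\<in>?C. s v * (2 ^ (d - length v) - 1))"
    by (rule sum.mono_neutral_right[OF fin]) (auto simp: s_def g_def)
  \<comment> \<open>\<open>?S\<close> gathers all the terms -1 from the subtree sizes, including
    that of the root.\<close>
  finally have card_X: "int (card X) + ?S = g [] * 2 ^ d + ?P"
    by (simp add: algebra_simps sum_subtractf)
  have "\<bar>\<Sum>v\<in>?C. s v\<bar> \<le> (\<Sum>v\<in>?C. \<bar>s v\<bar>)" by (rule sum_abs)
  also have "\<dots> \<le> (\<Sum>v\<in>?C. 1)" by (rule sum_mono) (use s in force)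
  finally have "\<bar>\<Sum>v\<in>?C. s v\<bar> \<le> int (card ?C)" by simp
  moreover have "0 \<le> g []" "g [] \<le> 1" by (auto simp: g_def)
  ultimately have S: "\<bar>?S\<bar> \<le> 1 + int (card ?C)" by linarith
  have "signed_weight (g [] * 2 ^ d + ?P) \<le> signed_weight (g [] * 2 ^ d) + card ?C"
    by (rule signed_weight_plus_sum[OF finC s])
  moreover have "signed_weight (g [] * 2 ^ d) \<le> 1"
    using signed_weight_plus_power[of 0 d] by (simp add: g_def)
  ultimately have "2 * int (signed_weight (int (card X))) \<le> 3 * int (card ?C) + 4"
    using signed_weight_diff_le[of "int (card X)" ?S] S unfolding card_X by linarith
  then show ?thesis using card_boundary_vertices_le_cut[of d X] by linarith
qed

section \<open>The peak and the choice of cardinality\<close>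

lemma edge_iso_le_iso_peak:
  assumes "1 \<le> i" and "i \<le> card (verts G)"
  shows "edge_iso i G \<le> iso_peak G"
  unfolding iso_peak_def using assms by (intro Max_ge) auto

lemma edge_iso_attained:
  assumes fin: "finite (verts G)" and i: "i \<le> card (verts G)"
  obtains X where "X \<subseteq> verts G" "card X = i" "edge_iso i G = card (cut G X)"
proof -
  let ?S = "{card (cut G X) | X. X \<subseteq> verts G \<and> card X = i}"
  have "finite ((\<lambda>X. card (cut G X)) ` Pow (verts G))" using fin by simp
  then have "finite ?S" by (rule rev_finite_subset) auto
  moreover obtain Y where "Y \<subseteq> verts G" "card Y = i"
    using obtain_subset_with_card_n[OF i] by metis
  then have "?S \<noteq> {}" by auto
  ultimately have "Min ?S \<in> ?S" by (rule Min_in)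
  then show ?thesis using that unfolding edge_iso_def by force
qed

theorem theorem3p25:
  fixes d :: nat
  assumes "d \<ge> 1"
  shows "int (iso_peak (binary_tree d)) \<ge> \<lfloor>real d / 3\<rfloor> - 1"
proof -
  let ?G = "binary_tree d"
  \<comment> \<open>This is the largest \<open>m\<close> for which
    \<open>i = (4 ^ m - 1) / 3\<close> does not exceed the \<open>2 ^ d - 1\<close>
    vertices.\<close>
  define m where "m = (d + 1) div 2"
  define i :: nat where "i = (\<Sum>j<m. 4 ^ j)"
  have m: "1 \<le> m" "d \<le> 2 * m" "2 * m \<le> Suc d" using assms by (auto simp: m_def)
  have i4: "3 * i + 1 = 4 ^ m"
    unfolding i_def by (induction m) auto
  also have "\<dots> = 2 ^ (2 * m)" by (simp add: power_mult)
  also have "\<dots> \<le> (2 :: nat) ^ Suc d" using m by (intro power_increasing) auto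
  finally have "3 * i + 1 \<le> 2 * 2 ^ d" by simp
  moreover have "(2 :: nat) ^ 1 \<le> 2 ^ d" using assms by (intro power_increasing) auto
  ultimately have i_le: "i \<le> card (verts ?G)"
    by (simp add: card_verts_binary_tree)
  have "(4 :: nat) ^ 1 \<le> 4 ^ m" using m by (intro power_increasing) auto
  then have i_ge: "1 \<le> i" using i4 by simp
  obtain X where X: "X \<subseteq> verts ?G" "card X = i" "edge_iso i ?G = card (cut ?G X)"
    using edge_iso_attained[OF finite_verts_binary_tree i_le] .
  have "m \<le> signed_weight (int i)"
    using signed_weight_sum_powers_4[of m] by (simp add: i_def)
  \<comment> \<open>Here \<open>d \<le> 2 * m\<close>, and \<open>2 * m\<close> is at most twice the
    weight of \<open>i\<close>.\<close>
  then have "d \<le> 3 * edge_iso i ?G + 4"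
    using signed_weight_card_le_cut[OF X(1)] X m by simp
  then have "d \<le> 3 * iso_peak ?G + 4"
    using edge_iso_le_iso_peak[OF i_ge i_le] by linarith
  \<comment> \<open>Dividing by 3 leaves an excess of 4/3 over the peak, which the floor reduces to
    1.\<close>
  then show ?thesis by linarith
qed

end
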